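(* Let $m,n$ be positive integers. For a face $F$ of $P(m,n)$ let $\mathcal{M}(F)$ be the set of sign matrices that are vertices of $F$, and set $\psi(F)=\bigcup_{M\in\mathcal{M}(F)} g(M)$. Then $\psi$ is a bijection between the faces of $P(m,n)$ and the components of $\overline\Gamma_{(m,n)}$.
   Context: A sign matrix is a matrix with entries in $\{-1,0,1\}$ whose column partial sums from the top lie in $\{0,1\}$ and whose row partial sums from the left are nonnegative; $P(m,n)$ is the convex hull in $\mathbb{R}^{mn}$ of all $m\times n$ sign matrices (its vertices are exactly these matrices). The grid graph $\Gamma_{(m,n)}$ has vertex set $\{(i,j):1\le i\le m+1,\ 1\le j\le n+1\}$ and edges: a "vertical" edge from $(i,j)$ to $(i+1,j)$ and a "horizontal" edge from $(i,j)$ to $(i,j+1)$ for each $1\le i\le m$, $1\le j\le n$. We consider labelings of $\Gamma_{(m,n)}$ in which each vertical edge gets a subset of $\{0,1\}$ and each horizontal edge gets a label in $\{0,\star\}$ or no label. For an $m\times n$ sign matrix $M$ with column partial sums $c_{ij}=\sum_{i'\le i}M_{i'j}$ and row partial sums $r_{ij}=\sum_{j'\le j}M_{ij'}$, the $0$-dimensional component $g(M)$ labels the vertical edge $(i,j)$–$(i+1,j)$ by $\{c_{ij}\}$ and the horizontal edge $(i,j)$–$(i,j+1)$ by $0$ if $r_{ij}=0$ and by $\star$ if $r_{ij}\neq 0$. The union of two labelings labels each vertical edge with the union of the two label sets and each horizontal edge with $\star$ if either label is $\star$ and $0$ otherwise (an absent label acting as identity). A component of $\overline\Gamma_{(m,n)}$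 is either the empty labeling (the empty component, all labels empty) or a union of a nonempty set of $0$-dimensional components $g(M)$. Faces of $P(m,n)$ include the empty face, which $\psi$ sends to the empty component. *)

theory Defs
  imports "HOL-Analysis.Analysis" "HOL-Analysis.Finite_Function_Topology"
begin

text \<open>
  An \<open>m \<times> n\<close> matrix is a finitely supported function on index pairs \<open>(i, j)\<close> (\<open>i\<close> the row, \<open>j\<close> the
  column) that vanishes outside \<open>{1..m} \<times> {1..n}\<close>. These functions form the coordinate subspace
  \<open>\<real>\<^sup>m\<^sup>n\<close> of the real vector space \<open>(nat \<times> nat) \<Rightarrow>\<^sub>0 real\<close>, so that \<open>m\<close> and \<open>n\<close> can be ordinary natural
  numbers. Convex hulls, faces and extreme points of sets in a subspace do not depend on the
  ambient space.
\<close>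

type_synonym matrix = "(nat \<times> nat) \<Rightarrow>\<^sub>0 real"

abbreviation entry :: "matrix \<Rightarrow> nat \<Rightarrow> nat \<Rightarrow> real" where
  "entry M i j \<equiv> Poly_Mapping.lookup M (i, j)"

definition col_psum :: "matrix \<Rightarrow> nat \<Rightarrow> nat \<Rightarrow> real" where
  "col_psum M i j = (\<Sum>i'=1..i. entry M i' j)"

definition row_psum :: "matrix \<Rightarrow> nat \<Rightarrow> nat \<Rightarrow> real" where
  "row_psum M i j = (\<Sum>j'=1..j. entry M i j')"

definition sign_matrices :: "nat \<Rightarrow> nat \<Rightarrow> matrix set" where
  "sign_matrices m n = {M.
     Poly_Mapping.keys M \<subseteq> {1..m} \<times> {1..n} \<and>
     (\<forall>i\<in>{1..m}. \<forall>j\<in>{1..n}.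
        entry M i j \<in> {-1, 0, 1} \<and> col_psum M i j \<in> {0, 1} \<and> row_psum M i j \<ge> 0)}"

definition sign_polytope :: "nat \<Rightarrow> nat \<Rightarrow> matrix set" where
  "sign_polytope m n = convex hull sign_matrices m n"

text \<open>The library's \<^const>\<open>face_of\<close> admits the empty face and the whole polytope.\<close>

definition polytope_faces :: "nat \<Rightarrow> nat \<Rightarrow> matrix set set" where
  "polytope_faces m n = {F. F face_of sign_polytope m n}"

definition face_sign_matrices :: "nat \<Rightarrow> nat \<Rightarrow> matrix set \<Rightarrow> matrix set" where
  "face_sign_matrices m n F = {M \<in> sign_matrices m n. M extreme_point_of F}"


text \<open>An edge is given by its endpoints, the upper (respectively left) one first.\<close>

type_synonym vertex = "nat \<times> nat"
type_synonym edge = "vertex \<times> vertex"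

definition grid_vertices :: "nat \<Rightarrow> nat \<Rightarrow> vertex set" where
  "grid_vertices m n = {1..m+1} \<times> {1..n+1}"

definition vertical_edges :: "nat \<Rightarrow> nat \<Rightarrow> edge set" where
  "vertical_edges m n = {((i, j), (i+1, j)) | i j. i \<in> {1..m} \<and> j \<in> {1..n}}"

definition horizontal_edges :: "nat \<Rightarrow> nat \<Rightarrow> edge set" where
  "horizontal_edges m n = {((i, j), (i, j+1)) | i j. i \<in> {1..m} \<and> j \<in> {1..n}}"

lemma edges_subset_vertices:
  "vertical_edges m n \<union> horizontal_edges m n \<subseteq> grid_vertices m n \<times> grid_vertices m n"
  by (auto simp: vertical_edges_def horizontal_edges_def grid_vertices_def)

datatype hlabel = Zero | Star

text \<open>
  Labels are total functions on pairs of vertices; a pair that is not an edge of the relevant kind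
  carries the empty label (\<open>{}\<close> or \<^const>\<open>None\<close>), which makes equality of labelings equality of the
  labels on the edges of the graph.
\<close>

record labeling =
  vlabel :: "edge \<Rightarrow> real set"
  hlabel :: "edge \<Rightarrow> hlabel option"

definition grid_labelings :: "nat \<Rightarrow> nat \<Rightarrow> labeling set" where
  "grid_labelings m n = {L.
     (\<forall>e. vlabel L e \<subseteq> (if e \<in> vertical_edges m n then {0, 1} else {})) \<and>
     (\<forall>e. e \<notin> horizontal_edges m n \<longrightarrow> hlabel L e = None)}"

definition empty_labeling :: labeling where
  "empty_labeling = \<lparr>vlabel = (\<lambda>_. {}), hlabel = (\<lambda>_. None)\<rparr>"

definition zero_dim_component :: "nat \<Rightarrow> nat \<Rightarrow> matrix \<Rightarrow> labeling" where
  "zero_dim_component m n M =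
     \<lparr>vlabel = (\<lambda>((i, j), w).
        if ((i, j), w) \<in> vertical_edges m n then {col_psum M i j} else {}),
      hlabel = (\<lambda>((i, j), w).
        if ((i, j), w) \<in> horizontal_edges m n
        then Some (if row_psum M i j = 0 then Zero else Star) else None)\<rparr>"

fun hlabel_union :: "hlabel option \<Rightarrow> hlabel option \<Rightarrow> hlabel option" where
  "hlabel_union None b = b"
| "hlabel_union a None = a"
| "hlabel_union (Some a) (Some b) = Some (if a = Star \<or> b = Star then Star else Zero)"

definition labeling_union :: "labeling \<Rightarrow> labeling \<Rightarrow> labeling" where
  "labeling_union L K =
     \<lparr>vlabel = (\<lambda>e. vlabel L e \<union> vlabel K e),
      hlabel = (\<lambda>e. hlabel_union (hlabel L e) (hlabel K e))\<rparr>"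

text \<open>
  Union of an arbitrary set of labelings; by the empty and insert lemmas below, on finite sets (such as
  all sets of zero-dimensional components) it is the iterated binary \<^const>\<open>labeling_union\<close>.
\<close>

definition labeling_Union :: "labeling set \<Rightarrow> labeling" where
  "labeling_Union \<L> =
     \<lparr>vlabel = (\<lambda>e. \<Union>L\<in>\<L>. vlabel L e),
      hlabel = (\<lambda>e. if \<exists>L\<in>\<L>. hlabel L e = Some Star then Some Star
                    else if \<exists>L\<in>\<L>. hlabel L e = Some Zero then Some Zero
                    else None)\<rparr>"

lemma labeling_Union_empty: "labeling_Union {} = empty_labeling"
  by (simp add: labeling_Union_def empty_labeling_def)

lemma hlabel_union_alt:
  "hlabel_union a b =
     (if a = Some Star \<or> b = Some Star then Some Star
      else if a = Some Zero \<or> b = Some Zero then Some Zero else None)"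
  by (cases "(a, b)" rule: hlabel_union.cases) (auto intro: hlabel.exhaust)

lemma labeling_Union_insert:
  "labeling_Union (insert L \<L>) = labeling_union L (labeling_Union \<L>)"
  by (auto simp: labeling_Union_def labeling_union_def hlabel_union_alt fun_eq_iff)

definition grid_components :: "nat \<Rightarrow> nat \<Rightarrow> labeling set" where
  "grid_components m n = insert empty_labeling
     {labeling_Union (zero_dim_component m n ` S) | S. S \<subseteq> sign_matrices m n \<and> S \<noteq> {}}"

lemma zero_dim_component_in_labelings:
  assumes "M \<in> sign_matrices m n"
  shows "zero_dim_component m n M \<in> grid_labelings m n"
  using assms
  by (auto simp: grid_labelings_def zero_dim_component_def vertical_edges_def
      horizontal_edges_def sign_matrices_def)

lemma labeling_Union_in_labelings:
  assumes "\<L> \<subseteq> grid_labelings m n"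
  shows "labeling_Union \<L> \<in> grid_labelings m n"
proof -
  have "vlabel L e \<subseteq> (if e \<in> vertical_edges m n then {0, 1} else {})" if "L \<in> \<L>" for L e
    using assms that unfolding grid_labelings_def by blast
  moreover have "hlabel L e = None" if "L \<in> \<L>" "e \<notin> horizontal_edges m n" for L e
    using assms that unfolding grid_labelings_def by blast
  ultimately show ?thesis
    unfolding grid_labelings_def labeling_Union_def by (simp add: UN_subset_iff)
qed

lemma grid_components_subset_labelings: "grid_components m n \<subseteq> grid_labelings m n"
proof -
  have "labeling_Union (zero_dim_component m n ` S) \<in> grid_labelings m n"
    if "S \<subseteq> sign_matrices m n" for S
    using that zero_dim_component_in_labelings by (intro labeling_Union_in_labelings) blast
  moreover have "empty_labeling \<in> grid_labelings m n"
    by (simp add: grid_labelings_def empty_labeling_def)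
  ultimately show ?thesis
    unfolding grid_components_def by blast
qed

definition psi :: "nat \<Rightarrow> nat \<Rightarrow> matrix set \<Rightarrow> labeling" where
  "psi m n F = labeling_Union (zero_dim_component m n ` face_sign_matrices m n F)"

end

theory Submission
  imports Defs
begin

text \<open>
  The label of an edge records which of the inequalities \<open>0 \<le> c\<^sub>i\<^sub>j\<close>, \<open>c\<^sub>i\<^sub>j \<le> 1\<close>, \<open>0 \<le> r\<^sub>i\<^sub>j\<close> are tight on
  a set of sign matrices. Every label pattern of a set \<open>S\<close> thus comes from the face cut out by the
  inequalities tight on \<open>S\<close>. Conversely, let \<open>F\<close> be a face with sign matrices \<open>T\<close>, and let \<open>M\<close> be a sign
  matrix for which all inequalities tight on \<open>T\<close> are tight. For large \<open>K\<close> the integer matrix \<open>K \<Sum>T - M\<close>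
  satisfies \<open>0 \<le> c\<^sub>i\<^sub>j \<le> D\<close> and \<open>0 \<le> r\<^sub>i\<^sub>j\<close> with \<open>D = K |T| - 1\<close>, and any such matrix is a sum of \<open>D\<close> sign
  matrices: if \<open>h\<close> is its corner sum, the summands have corner sums \<open>(h + t) div D\<close> for \<open>t < D\<close>, which add
  up to \<open>h\<close> by Hermite's identity. So the barycentre of \<open>T\<close> is a convex combination in which \<open>M\<close> has
  positive weight, and \<open>M\<close> lies in \<open>F\<close>.
\<close>

section \<open>Faces of convex sets\<close>

text \<open>The point is \<open>w k *\<^sub>R x k + (1 - w k) *\<^sub>R y\<close>, where
  \<open>y\<close> is the normalised combination of the other points. Unless \<open>w k = 1\<close>
  or \<open>y = x k\<close>, it lies in the open segment between \<open>y\<close> and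
  \<open>x k\<close>, and the defining property of a face applies.\<close>

lemma face_of_mem_weighted_sum:
  fixes P :: "'a::real_vector set"
  assumes F: "F face_of P" and P: "convex P" and I: "finite I"
    and w: "\<And>i. i \<in> I \<Longrightarrow> 0 \<le> w i" "sum w I = 1"
    and x: "\<And>i. i \<in> I \<Longrightarrow> x i \<in> P" and sum: "(\<Sum>i\<in>I. w i *\<^sub>R x i) \<in> F"
    and k: "k \<in> I" "0 < w k"
  shows "x k \<in> F"
proof -
  have split: "(\<Sum>i\<in>I. w i *\<^sub>R x i) = w k *\<^sub>R x k + (\<Sum>i\<in>I-{k}. w i *\<^sub>R x i)"
    using I k by (simp add: sum.remove)
  have rest: "sum w (I - {k}) = 1 - w k"
    using I k w(2) by (simp add: sum_diff1)
  show ?thesis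
  proof (cases "w k = 1")
    case True
    then have "w i = 0" if "i \<in> I - {k}" for i
      using rest that I w(1) by (metis Diff_iff cancel_comm_monoid_add_class.diff_cancel finite_Diff
          sum_nonneg_eq_0_iff)
    then have "(\<Sum>i\<in>I. w i *\<^sub>R x i) = x k"
      unfolding split using True by simp
    then show ?thesis using sum by simp
  next
    case False
    have "0 \<le> sum w (I - {k})" using w(1) by (intro sum_nonneg) auto
    then have lt: "w k < 1" using False rest by simp
    define y where "y = (\<Sum>i\<in>I-{k}. (w i / (1 - w k)) *\<^sub>R x i)"
    have "(\<Sum>i\<in>I-{k}. w i / (1 - w k)) = 1"
      using rest lt by (simp flip: sum_divide_distrib)
    then have y: "y \<in> P"
      unfolding y_def using I P w(1) x lt by (intro convex_sum) auto
    have "(1 - w k) *\<^sub>R y = (\<Sum>i\<in>I-{k}. w i *\<^sub>R x i)"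
      unfolding y_def using lt by (simp add: scaleR_sum_right)
    then have eq: "(\<Sum>i\<in>I. w i *\<^sub>R x i) = (1 - w k) *\<^sub>R y + w k *\<^sub>R x k"
      unfolding split by simp
    show ?thesis
    proof (cases "y = x k")
      case True
      then show ?thesis using sum unfolding eq by (simp flip: scaleR_left_distrib)
    next
      case False
      then have "(\<Sum>i\<in>I. w i *\<^sub>R x i) \<in> open_segment y (x k)"
        unfolding eq in_segment using lt k(2) by blast
      then show ?thesis using F sum x[OF k(1)] y by (blast dest: face_ofD)
    qed
  qed
qed

text \<open>By the preceding lemma, a representation of a point of \<open>F\<close> uses with
  positive weight only points of \<open>F\<close>. Hence a face of the polytope is determined by the
  sign matrices in it, which injectivity of \<open>psi\<close> rests on.\<close>

lemma face_of_convex_hull_eq: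
  fixes S :: "'a::real_vector set"
  assumes F: "F face_of convex hull S"
  shows "F = convex hull (S \<inter> F)"
proof
  show "convex hull (S \<inter> F) \<subseteq> F"
    using F by (intro hull_minimal) (auto dest: face_of_imp_convex)
  show "F \<subseteq> convex hull (S \<inter> F)"
  proof
    fix x assume x: "x \<in> F"
    then have "x \<in> convex hull S" using F face_of_imp_subset by blast
    then obtain T u where T: "finite T" "T \<subseteq> S" "\<forall>v\<in>T. 0 \<le> u v" "sum u T = 1"
      and xT: "(\<Sum>v\<in>T. u v *\<^sub>R v) = x"
      unfolding convex_hull_explicit by blast
    define T' where "T' = {v \<in> T. 0 < u v}"
    have zero: "\<forall>v\<in>T - T'. u v = 0" using T(3) by (force simp: T'_def)
    have "v \<in> F" if "v \<in> T'" for v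
      using face_of_mem_weighted_sum[OF F convex_convex_hull T(1), of u "\<lambda>v. v" v] T xT x that hull_subset
      by (fastforce simp: T'_def)
    moreover have "sum u T' = 1"
      using T zero by (metis (no_types, lifting) T'_def mem_Collect_eq subsetI sum.mono_neutral_right)
    moreover have "(\<Sum>v\<in>T'. u v *\<^sub>R v) = x"
      using T zero xT by (metis (no_types, lifting) T'_def mem_Collect_eq subsetI sum.mono_neutral_right
          scale_eq_0_iff)
    ultimately show "x \<in> convex hull (S \<inter> F)"
      unfolding convex_hull_explicit using T by (auto simp: T'_def intro!: exI[of _ T'] exI[of _ u])
  qed
qed

text \<open>Affinity rather than linearity, because \<open>1 - col_psum M i j\<close> has a constant
  term.\<close>

definition affine_fun :: "('a::real_vector \<Rightarrow> real) \<Rightarrow> bool" where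
  "affine_fun f \<longleftrightarrow> (\<forall>x y u. f ((1 - u) *\<^sub>R x + u *\<^sub>R y) = (1 - u) * f x + u * f y)"

text \<open>An affine function that is nonnegative at both ends of a segment and zero strictly
  between them is zero at both ends.\<close>

lemma face_of_affine_fun_zeros:
  fixes P :: "'a::real_vector set"
  assumes P: "convex P" and aff: "\<And>f. f \<in> \<F> \<Longrightarrow> affine_fun f"
    and nonneg: "\<And>f x. f \<in> \<F> \<Longrightarrow> x \<in> P \<Longrightarrow> 0 \<le> f x"
  shows "{x \<in> P. \<forall>f\<in>\<F>. f x = 0} face_of P"
  unfolding face_of_def
proof (intro conjI ballI impI)
  show "convex {x \<in> P. \<forall>f\<in>\<F>. f x = 0}"
    unfolding convex_alt
  proof clarify
    fix x y u f
    assume xy: "x \<in> P" "\<forall>f\<in>\<F>. f x = 0" "y \<in> P" "\<forall>f\<in>\<F>. f y = 0" and u: "0 \<le> u" "u \<le> (1::real)"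
    have "f ((1 - u) *\<^sub>R x + u *\<^sub>R y) = 0" if f: "f \<in> \<F>" for f
      using aff[OF f] xy f by (auto simp: affine_fun_def simp del: scaleR_left_diff_distrib)
    then show "(1 - u) *\<^sub>R x + u *\<^sub>R y \<in> P \<and> (\<forall>f\<in>\<F>. f ((1 - u) *\<^sub>R x + u *\<^sub>R y) = 0)"
      using P xy u unfolding convex_alt by blast
  qed
  fix a b x
  assume ab: "a \<in> P" "b \<in> P" and x: "x \<in> {x \<in> P. \<forall>f\<in>\<F>. f x = 0}" "x \<in> open_segment a b"
  then obtain u where u: "0 < u" "u < 1" "x = (1 - u) *\<^sub>R a + u *\<^sub>R b"
    unfolding in_segment by blast
  have "f a = 0 \<and> f b = 0" if f: "f \<in> \<F>" for f
  proof -
    have "(1 - u) * f a + u * f b = 0"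
      using x f aff[OF f] u(3) by (auto simp: affine_fun_def)
    moreover have "0 \<le> (1 - u) * f a" "0 \<le> u * f b"
      using u nonneg[OF f] ab by auto
    ultimately have "(1 - u) * f a = 0" "u * f b = 0" by linarith+
    then show ?thesis using u by simp
  qed
  then show "a \<in> {x \<in> P. \<forall>f\<in>\<F>. f x = 0}" "b \<in> {x \<in> P. \<forall>f\<in>\<F>. f x = 0}"
    using ab by auto
qed auto

lemma affine_fun_nonneg_convex_hull:
  assumes aff: "affine_fun f" and S: "\<And>x. x \<in> S \<Longrightarrow> 0 \<le> f x" and x: "x \<in> convex hull S"
  shows "0 \<le> f x"
proof -
  have "convex {x. 0 \<le> f x}"
    using aff unfolding convex_alt affine_fun_def by simp
  then have "convex hull S \<subseteq> {x. 0 \<le> f x}"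
    using S by (intro hull_minimal) auto
  then show ?thesis using x by auto
qed

section \<open>Sign matrices and their slacks\<close>

lemma lookup_scaleR [simp]: "Poly_Mapping.lookup (c *\<^sub>R M) k = c *\<^sub>R Poly_Mapping.lookup M k"
  by (simp add: scaleR_poly_mapping_def Poly_Mapping.map.rep_eq when_def)

lemma linear_col_psum: "linear (\<lambda>M. col_psum M i j)"
  by (rule linearI) (simp_all add: col_psum_def lookup_add sum.distrib sum_distrib_left)

lemma linear_row_psum: "linear (\<lambda>M. row_psum M i j)"
  by (rule linearI) (simp_all add: row_psum_def lookup_add sum.distrib sum_distrib_left)

text \<open>Each inequality is stored as a function that is nonnegative on the polytope, so
  tightness becomes vanishing and the three kinds can be treated alike.\<close>

definition slacks :: "nat \<Rightarrow> nat \<Rightarrow> (matrix \<Rightarrow> real) set" where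
  "slacks m n = (\<Union>i\<in>{1..m}. \<Union>j\<in>{1..n}.
     {\<lambda>M. col_psum M i j, \<lambda>M. 1 - col_psum M i j, \<lambda>M. row_psum M i j})"

lemma slacksI:
  assumes "i \<in> {1..m}" "j \<in> {1..n}"
  shows "(\<lambda>M. col_psum M i j) \<in> slacks m n" "(\<lambda>M. 1 - col_psum M i j) \<in> slacks m n"
    "(\<lambda>M. row_psum M i j) \<in> slacks m n"
  using assms unfolding slacks_def by blast+

lemma affine_fun_slack:
  assumes "f \<in> slacks m n"
  shows "affine_fun f"
proof -
  have "affine_fun g" if "linear g" for g :: "matrix \<Rightarrow> real"
    using that by (simp add: affine_fun_def linear_add linear_scale)
  moreover have "affine_fun (\<lambda>M. 1 - g M)" if "linear g" for g :: "matrix \<Rightarrow> real"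
    using that by (simp add: affine_fun_def linear_add linear_scale) (simp add: algebra_simps)
  ultimately show ?thesis
    using assms linear_col_psum linear_row_psum by (auto simp: slacks_def)
qed

lemma sign_matrix_entry:
  assumes "M \<in> sign_matrices m n"
  shows "entry M i j \<in> {-1, 0, 1}"
proof (cases "(i, j) \<in> Poly_Mapping.keys M")
  case True
  then show ?thesis using assms by (fastforce simp: sign_matrices_def)
qed (simp add: in_keys_iff)

lemma sign_matrix_outside:
  assumes "M \<in> sign_matrices m n" "k \<notin> {1..m} \<times> {1..n}"
  shows "Poly_Mapping.lookup M k = 0"
  using assms unfolding sign_matrices_def mem_Collect_eq by (metis in_keys_iff subsetD)

lemma finite_sign_matrices: "finite (sign_matrices m n)"
proof (rule inj_on_finite)
  show "inj_on Poly_Mapping.lookup (sign_matrices m n)"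
    by (simp add: inj_on_def poly_mapping_eqI)
  show "finite {f :: nat \<times> nat \<Rightarrow> real. \<forall>x. (x \<in> {1..m} \<times> {1..n} \<longrightarrow> f x \<in> {-1, 0, 1}) \<and>
      (x \<notin> {1..m} \<times> {1..n} \<longrightarrow> f x = 0)}"
    by (rule finite_set_of_finite_funs) auto
  show "Poly_Mapping.lookup ` sign_matrices m n \<subseteq> {f. \<forall>x. (x \<in> {1..m} \<times> {1..n} \<longrightarrow> f x \<in> {-1, 0, 1}) \<and>
      (x \<notin> {1..m} \<times> {1..n} \<longrightarrow> f x = 0)}"
  proof clarify
    fix M :: matrix and i j assume M: "M \<in> sign_matrices m n"
    show "((i, j) \<in> {1..m} \<times> {1..n} \<longrightarrow> entry M i j \<in> {-1, 0, 1}) \<and>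
        ((i, j) \<notin> {1..m} \<times> {1..n} \<longrightarrow> entry M i j = 0)"
      using sign_matrix_entry[OF M] sign_matrix_outside[OF M] by blast
  qed
qed

text \<open>A row partial sum has at most \<open>n\<close> terms, each at most 1, and a column slack
  is 0 or 1. By integrality a nonzero slack is at least 1, so \<open>n\<close> times it dominates
  the same slack of any other sign matrix.\<close>

lemma slack_sign_matrix:
  assumes M: "M \<in> sign_matrices m n" and f: "f \<in> slacks m n"
  shows "f M \<in> \<int>" "0 \<le> f M" "f M \<le> n"
proof -
  from f obtain i j where ij: "i \<in> {1..m}" "j \<in> {1..n}"
    and f_cases: "f = (\<lambda>M. col_psum M i j) \<or> f = (\<lambda>M. 1 - col_psum M i j) \<or> f = (\<lambda>M. row_psum M i j)"
    by (auto simp: slacks_def)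
  have c: "col_psum M i j \<in> {0, 1}" and r: "0 \<le> row_psum M i j"
    using M ij by (auto simp: sign_matrices_def)
  have "row_psum M i j \<in> \<int>"
    unfolding row_psum_def
  proof (rule Ints_sum)
    show "entry M i j' \<in> \<int>" for j' using sign_matrix_entry[OF M, of i j'] by auto
  qed
  moreover have "row_psum M i j \<le> (\<Sum>j'=1..j. 1)"
    unfolding row_psum_def
  proof (rule sum_mono)
    show "entry M i j' \<le> 1" for j' using sign_matrix_entry[OF M, of i j'] by auto
  qed
  ultimately show "f M \<in> \<int>" "0 \<le> f M" "f M \<le> n"
    using f_cases c r ij by auto
qed

lemma slack_nonneg:
  assumes "f \<in> slacks m n" "X \<in> sign_polytope m n"
  shows "0 \<le> f X"
  using assms affine_fun_nonneg_convex_hull[OF affine_fun_slack] slack_sign_matrix(2)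
  unfolding sign_polytope_def by blast

lemma keys_sign_polytope:
  assumes "X \<in> sign_polytope m n"
  shows "Poly_Mapping.keys X \<subseteq> {1..m} \<times> {1..n}"
proof -
  let ?V = "{X :: matrix. Poly_Mapping.keys X \<subseteq> {1..m} \<times> {1..n}}"
  have "?V = {X. \<forall>k. k \<notin> {1..m} \<times> {1..n} \<longrightarrow> Poly_Mapping.lookup X k = 0}"
    by (simp add: subset_iff in_keys_iff) blast
  then have "convex ?V"
    by (simp add: convex_alt lookup_add)
  then have "convex hull sign_matrices m n \<subseteq> ?V"
    by (intro hull_minimal) (auto simp: sign_matrices_def)
  then show ?thesis using assms by (auto simp: sign_polytope_def)
qed

section \<open>Sign matrices as vertices of the polytope\<close>

lemma matrix_eqI_col_psum:
  assumes keys: "Poly_Mapping.keys A \<subseteq> {1..m} \<times> {1..n}" "Poly_Mapping.keys B \<subseteq> {1..m} \<times> {1..n}"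
    and eq: "\<And>i j. i \<in> {1..m} \<Longrightarrow> j \<in> {1..n} \<Longrightarrow> col_psum A i j = col_psum B i j"
  shows "A = B"
proof (rule poly_mapping_eqI)
  fix k :: "nat \<times> nat"
  obtain i j where k: "k = (i, j)" by (cases k)
  show "Poly_Mapping.lookup A k = Poly_Mapping.lookup B k"
  proof (cases "k \<in> {1..m} \<times> {1..n}")
    case True
    then obtain i' where i: "i = Suc i'" using k by (cases i) auto
    have diff: "entry M i j = col_psum M i j - col_psum M i' j" for M
      by (simp add: col_psum_def i)
    \<comment> \<open>For \<open>i' = 0\<close>, where \<open>eq\<close> says nothing, both sums are
      empty.\<close>
    have "col_psum A i' j = col_psum B i' j"
      using eq[of i' j] True k i by (cases "i' = 0") (auto simp: col_psum_def)
    then show ?thesis using eq[of i j] True k by (simp add: diff)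
  next
    case False
    then show ?thesis using keys by (metis in_keys_iff subsetD)
  qed
qed

text \<open>Every column partial sum of \<open>M\<close> is 0 or 1, an end of its range on the
  polytope. The ends of a segment through \<open>M\<close> must therefore share all column partial
  sums, and these determine a matrix.\<close>

lemma sign_matrix_extreme_point:
  assumes M: "M \<in> sign_matrices m n"
  shows "M extreme_point_of sign_polytope m n"
  unfolding extreme_point_of_def
proof (intro conjI ballI notI)
  show "M \<in> sign_polytope m n" using M by (simp add: sign_polytope_def hull_inc)
  fix a b assume ab: "a \<in> sign_polytope m n" "b \<in> sign_polytope m n" and "M \<in> open_segment a b"
  then obtain u where "a \<noteq> b" and u: "0 < u" "u < 1" and Meq: "M = (1 - u) *\<^sub>R a + u *\<^sub>R b"
    unfolding in_segment by blast
  have "col_psum a i j = col_psum b i j" if ij: "i \<in> {1..m}" "j \<in> {1..n}" for i j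
  proof -
    have *: "f a = 0 \<and> f b = 0" if f: "f \<in> slacks m n" "f M = 0" for f
    proof -
      have "(1 - u) * f a + u * f b = 0"
        using f affine_fun_slack[OF f(1)] unfolding affine_fun_def Meq by simp
      moreover have "0 \<le> (1 - u) * f a" "0 \<le> u * f b"
        using u slack_nonneg[OF f(1)] ab by auto
      ultimately have "(1 - u) * f a = 0" "u * f b = 0" by linarith+
      then show ?thesis using u by simp
    qed
    have "(\<lambda>M. col_psum M i j) \<in> slacks m n" "(\<lambda>M. 1 - col_psum M i j) \<in> slacks m n"
      using slacksI[OF ij] by auto
    moreover have "col_psum M i j \<in> {0, 1}" using M ij by (auto simp: sign_matrices_def)
    ultimately show ?thesis
      using *[of "\<lambda>M. col_psum M i j"] *[of "\<lambda>M. 1 - col_psum M i j"] by auto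
  qed
  then have "a = b" using matrix_eqI_col_psum keys_sign_polytope ab by blast
  with \<open>a \<noteq> b\<close> show False by simp
qed

lemma face_sign_matrices_eq:
  assumes "F face_of sign_polytope m n"
  shows "face_sign_matrices m n F = sign_matrices m n \<inter> F"
  using sign_matrix_extreme_point extreme_point_of_face[OF assms]
  by (auto simp: face_sign_matrices_def)

section \<open>Decomposition into sign matrices\<close>

text \<open>Replacing \<open>h\<close> by \<open>Suc h\<close> drops the term \<open>h div D\<close>
  and gains \<open>(h + D) div D\<close>, which is larger by one.\<close>

lemma sum_shifted_div:
  fixes D h :: nat
  assumes "D > 0"
  shows "(\<Sum>t<D. (h + t) div D) = h"
proof (induction h)
  case (Suc h)
  have "(\<Sum>t<D. (Suc h + t) div D) + h div D = (\<Sum>t<Suc D. (h + t) div D)"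
    by (subst sum.lessThan_Suc_shift) simp
  also have "\<dots> = h + Suc (h div D)"
    using assms Suc by simp
  finally show ?case by simp
qed simp

text \<open>Entries are mixed second differences of \<open>G\<close>, so summing in one direction
  telescopes and leaves a first difference in the other.\<close>

lemma psum_of_corner_sum:
  fixes M :: matrix and G :: "nat \<Rightarrow> nat \<Rightarrow> real"
  assumes entry: "\<And>i j. i \<in> {1..m} \<Longrightarrow> j \<in> {1..n} \<Longrightarrow>
      entry M i j = G i j - G i (j - 1) - G (i - 1) j + G (i - 1) (j - 1)"
    and zero: "\<And>i. G i 0 = 0" "\<And>j. G 0 j = 0"
    and ij: "i \<in> {1..m}" "j \<in> {1..n}"
  shows "col_psum M i j = G i j - G i (j - 1)" "row_psum M i j = G i j - G (i - 1) j"
proof -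
  have "col_psum M i j = (\<Sum>i'=Suc 0..i. (G i' j - G i' (j - 1)) - (G (i' - 1) j - G (i' - 1) (j - 1)))"
    unfolding col_psum_def using ij by (intro sum.cong) (auto simp: entry)
  also have "\<dots> = (G i j - G i (j - 1)) - (G 0 j - G 0 (j - 1))"
    by (rule sum_telescope'') simp
  finally show "col_psum M i j = G i j - G i (j - 1)" by (simp add: zero)
  have "row_psum M i j = (\<Sum>j'=Suc 0..j. (G i j' - G (i - 1) j') - (G i (j' - 1) - G (i - 1) (j' - 1)))"
    unfolding row_psum_def using ij by (intro sum.cong) (auto simp: entry)
  also have "\<dots> = (G i j - G (i - 1) j) - (G i 0 - G (i - 1) 0)"
    by (rule sum_telescope'') simp
  finally show "row_psum M i j = G i j - G (i - 1) j" by (simp add: zero)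
qed

text \<open>The conditions on \<open>g\<close> are those on partial sums, read as first differences.
  An entry is a difference of two horizontal steps of \<open>g\<close>, each 0 or 1, hence lies in
  \<open>{-1, 0, 1}\<close>.\<close>

lemma sign_matrix_of_corner_sum:
  fixes g :: "nat \<Rightarrow> nat \<Rightarrow> nat"
  assumes zero: "\<And>i. g i 0 = 0" "\<And>j. g 0 j = 0"
    and col: "\<And>i j. i \<in> {1..m} \<Longrightarrow> j \<in> {1..n} \<Longrightarrow> g i (j - 1) \<le> g i j \<and> g i j \<le> Suc (g i (j - 1))"
    and row: "\<And>i j. i \<in> {1..m} \<Longrightarrow> j \<in> {1..n} \<Longrightarrow> g (i - 1) j \<le> g i j"
  obtains M where "M \<in> sign_matrices m n"
    "\<And>i j. i \<in> {1..m} \<Longrightarrow> j \<in> {1..n} \<Longrightarrow>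
      entry M i j = real (g i j) - g i (j - 1) - g (i - 1) j + g (i - 1) (j - 1)"
proof -
  let ?e = "\<lambda>(i, j). if (i, j) \<in> {1..m} \<times> {1..n}
      then real (g i j) - g i (j - 1) - g (i - 1) j + g (i - 1) (j - 1) else 0"
  define M :: matrix where "M = Abs_poly_mapping ?e"
  have sub: "{k. ?e k \<noteq> 0} \<subseteq> {1..m} \<times> {1..n}" by (auto split: if_splits)
  then have "finite {k. ?e k \<noteq> 0}" by (rule finite_subset) simp
  then have lookup: "Poly_Mapping.lookup M = ?e"
    unfolding M_def by (rule lookup_Abs_poly_mapping)
  then have e: "entry M i j = real (g i j) - g i (j - 1) - g (i - 1) j + g (i - 1) (j - 1)"
    if "i \<in> {1..m}" "j \<in> {1..n}" for i j using that by simp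
  note psum = psum_of_corner_sum[of m n M "\<lambda>i j. real (g i j)", simplified zero, OF e, simplified]
  have step: "g i j = g i (j - 1) \<or> g i j = Suc (g i (j - 1))" if "i \<in> {1..m}" "j \<in> {1..n}" for i j
    using col[OF that] by auto
  \<comment> \<open>Row \<open>i - 1\<close> may be row 0, which \<open>col\<close> does not cover;
    there \<open>g\<close> vanishes.\<close>
  have step': "g (i - 1) j = g (i - 1) (j - 1) \<or> g (i - 1) j = Suc (g (i - 1) (j - 1))"
    if "i \<in> {1..m}" "j \<in> {1..n}" for i j
  proof (cases "i = 1")
    case False
    then have "i - 1 \<in> {1..m}" using that by auto
    then show ?thesis using step that(2) by blast
  qed (simp add: zero)
  have "M \<in> sign_matrices m n"
    unfolding sign_matrices_def mem_Collect_eq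
  proof (intro conjI ballI)
    show "Poly_Mapping.keys M \<subseteq> {1..m} \<times> {1..n}"
      using sub unfolding Poly_Mapping.keys.rep_eq lookup .
    fix i j assume ij: "i \<in> {1..m}" "j \<in> {1..n}"
    show "entry M i j \<in> {-1, 0, 1}"
      using step[OF ij] step'[OF ij] by (auto simp: e[OF ij])
    show "col_psum M i j \<in> {0, 1}"
      using step[OF ij] ij by (auto simp: psum)
    show "0 \<le> row_psum M i j"
      using row[OF ij] ij by (simp add: psum)
  qed
  from that[OF this e] show thesis .
qed

lemma sum_of_sign_matrices:
  fixes Y :: matrix and D :: nat
  assumes D: "D > 0" and keys: "Poly_Mapping.keys Y \<subseteq> {1..m} \<times> {1..n}"
    and int: "\<And>i j. entry Y i j \<in> \<int>"
    and col: "\<And>i j. i \<in> {1..m} \<Longrightarrow> j \<in> {1..n} \<Longrightarrow> 0 \<le> col_psum Y i j \<and> col_psum Y i j \<le> D"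
    and row: "\<And>i j. i \<in> {1..m} \<Longrightarrow> j \<in> {1..n} \<Longrightarrow> 0 \<le> row_psum Y i j"
  obtains Z where "\<And>t. t < D \<Longrightarrow> Z t \<in> sign_matrices m n" "Y = (\<Sum>t<D. Z t)"
proof -
  \<comment> \<open>The corner sum of \<open>Y\<close>; summing by columns or by rows gives both
    kinds of first difference.\<close>
  define H where "H i j = (\<Sum>j'=1..j. col_psum Y i j')" for i j
  have H_row: "H i j = (\<Sum>i'=1..i. row_psum Y i' j)" for i j
    unfolding H_def col_psum_def row_psum_def by (rule sum.swap)
  \<comment> \<open>A natural-number copy of \<open>H\<close>, so that \<open>div\<close> is
    available. The floor changes nothing, as \<open>H\<close> is a nonnegative integer on the
    grid.\<close>
  define h where "h i j = (if i \<in> {1..m} \<and> j \<in> {1..n} then nat \<lfloor>H i j\<rfloor> else 0)" for i j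
  have h0: "h i 0 = 0" "h 0 j = 0" for i j by (simp_all add: h_def)
  have H: "real (h i j) = H i j" if "i \<le> m" "j \<le> n" for i j
  proof (cases "i = 0 \<or> j = 0")
    case True
    then show ?thesis by (auto simp: h_def H_def col_psum_def)
  next
    case False
    have "H i j \<in> \<int>" unfolding H_def col_psum_def by (intro Ints_sum int)
    moreover have "0 \<le> H i j" unfolding H_def using col that False by (intro sum_nonneg) auto
    ultimately show ?thesis using that False by (auto simp: h_def elim!: Ints_cases)
  qed
  have hcol: "real (h i j) - h i (j - 1) = col_psum Y i j" if "i \<in> {1..m}" "j \<in> {1..n}" for i j
    using that by (cases j) (auto simp: H H_def)
  have hrow: "real (h i j) - h (i - 1) j = row_psum Y i j" if "i \<in> {1..m}" "j \<in> {1..n}" for i j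
    using that by (cases i) (auto simp: H H_row)
  have hcol_le: "h i (j - 1) \<le> h i j \<and> h i j \<le> h i (j - 1) + D" if "i \<in> {1..m}" "j \<in> {1..n}" for i j
    using hcol[OF that] col[OF that] by linarith
  have hrow_le: "h (i - 1) j \<le> h i j" if "i \<in> {1..m}" "j \<in> {1..n}" for i j
    using hrow[OF that] row[OF that] by linarith
  define g where "g t i j = (h i j + t) div D" for t i j
  have "\<exists>M. M \<in> sign_matrices m n \<and> (\<forall>i\<in>{1..m}. \<forall>j\<in>{1..n}.
      entry M i j = real (g t i j) - g t i (j - 1) - g t (i - 1) j + g t (i - 1) (j - 1))"
    if t: "t < D" for t
  proof (rule sign_matrix_of_corner_sum[of "g t" m n])
    \<comment> \<open>On the border \<open>h\<close> is 0, and \<open>t div D = 0\<close> because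
      \<open>t < D\<close>.\<close>
    show "g t i 0 = 0" "g t 0 j = 0" for i j using t by (simp_all add: g_def h0)
    fix i j assume ij: "i \<in> {1..m}" "j \<in> {1..n}"
    \<comment> \<open>A horizontal step of \<open>h\<close> is at most \<open>D\<close>, and adding
      \<open>D\<close> raises the quotient by exactly one.\<close>
    have "(h i j + t) div D \<le> (h i (j - 1) + t + D) div D"
      using hcol_le[OF ij] by (intro div_le_mono) auto
    then show "g t i (j - 1) \<le> g t i j \<and> g t i j \<le> Suc (g t i (j - 1))"
      using hcol_le[OF ij] D by (auto simp: g_def intro: div_le_mono)
    show "g t (i - 1) j \<le> g t i j"
      using hrow_le[OF ij] by (auto simp: g_def intro: div_le_mono)
  qed blast
  then obtain Z where Z: "\<And>t. t < D \<Longrightarrow> Z t \<in> sign_matrices m n"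
    and eZ: "\<And>t i j. t < D \<Longrightarrow> i \<in> {1..m} \<Longrightarrow> j \<in> {1..n} \<Longrightarrow>
      entry (Z t) i j = real (g t i j) - g t i (j - 1) - g t (i - 1) j + g t (i - 1) (j - 1)"
    by metis
  \<comment> \<open>Hermite's identity: the corner sums \<open>g t\<close> add up to
    \<open>h\<close>, and entries depend linearly on corner sums.\<close>
  have sum_g: "(\<Sum>t<D. real (g t i j)) = real (h i j)" for i j
    using sum_shifted_div[OF D] by (simp add: g_def flip: of_nat_sum)
  have "Y = (\<Sum>t<D. Z t)"
  proof (rule poly_mapping_eqI)
    fix k :: "nat \<times> nat"
    obtain i j where k: "k = (i, j)" by (cases k)
    show "Poly_Mapping.lookup Y k = Poly_Mapping.lookup (\<Sum>t<D. Z t) k"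
    proof (cases "k \<in> {1..m} \<times> {1..n}")
      case True
      then have ij: "i \<in> {1..m}" "j \<in> {1..n}" using k by auto
      obtain i' where i: "i = Suc i'" using ij by (cases i) auto
      have "entry Y i j = col_psum Y i j - col_psum Y i' j" by (simp add: col_psum_def i)
      also have "col_psum Y i' j = real (h i' j) - h i' (j - 1)"
        using hcol[of i' j] ij i by (cases "i' = 0") (auto simp: h0 col_psum_def)
      also have "col_psum Y i j - (real (h i' j) - h i' (j - 1)) =
          real (h i j) - h i (j - 1) - h (i - 1) j + h (i - 1) (j - 1)"
        using hcol[OF ij] i by simp
      also have "\<dots> = (\<Sum>t<D. entry (Z t) i j)"
        using ij by (simp add: eZ sum.distrib sum_subtractf sum_g)
      finally show ?thesis by (simp add: k lookup_sum)
    next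
      case False
      then have "Poly_Mapping.lookup (Z t) k = 0" if "t < D" for t
        using sign_matrix_outside[OF Z[OF that]] by blast
      moreover have "Poly_Mapping.lookup Y k = 0" using False keys by (auto simp: in_keys_iff)
      ultimately show ?thesis by (simp add: lookup_sum)
    qed
  qed
  from that[OF Z this] show thesis .
qed

section \<open>Membership in a face from its tight inequalities\<close>

lemma sign_matrix_in_face:
  assumes F: "F face_of sign_polytope m n" and M: "M \<in> sign_matrices m n"
    and n: "n > 0" and T: "sign_matrices m n \<inter> F \<noteq> {}"
    and tight: "\<And>f. f \<in> slacks m n \<Longrightarrow> \<forall>N\<in>sign_matrices m n \<inter> F. f N = 0 \<Longrightarrow> f M = 0"
  shows "M \<in> F"
proof -
  define T where "T = sign_matrices m n \<inter> F"
  \<comment> \<open>Here \<open>Suc n\<close> is the multiple of the sum of \<open>T\<close>, while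
    \<open>K\<close> counts the sign matrices that make up \<open>Y + M\<close>, and
    \<open>D\<close> those that make up \<open>Y\<close>. With \<open>Suc n\<close> and
    \<open>n > 0\<close>, \<open>K\<close> is at least 2, so \<open>D > 0\<close>.\<close>
  define K where "K = Suc n * card T"
  define D where "D = K - 1"
  define Y where "Y = real (Suc n) *\<^sub>R (\<Sum>N\<in>T. N) - M"
  have fin: "finite T" using finite_sign_matrices by (auto simp: T_def)
  have card: "card T > 0" using T fin by (simp add: T_def card_gt_0_iff)
  have TS: "N \<in> sign_matrices m n" if "N \<in> T" for N using that by (simp add: T_def)
  have "K \<ge> 2" using card n by (cases "card T") (auto simp: K_def)
  then have D: "D > 0" and KD: "K = Suc D" by (auto simp: D_def)
  \<comment> \<open>Either \<open>f\<close> vanishes on \<open>T\<close> and hence at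
    \<open>M\<close>, or some slack on \<open>T\<close> is at least 1 by integrality and
    \<open>Suc n\<close> times it exceeds the bound \<open>n\<close> on \<open>f M\<close>.\<close>
  have slack_sum: "f M \<le> real (Suc n) * (\<Sum>N\<in>T. f N)"
    if f: "f \<in> slacks m n" for f :: "matrix \<Rightarrow> real"
  proof (cases "\<forall>N\<in>T. f N = 0")
    case True
    then show ?thesis using tight[OF f] by (simp add: T_def)
  next
    case False
    then obtain N where N: "N \<in> T" "f N \<noteq> 0" by blast
    note sN = slack_sign_matrix[OF TS[OF N(1)] f]
    have "1 \<le> f N" using sN N(2) by (auto elim!: Ints_cases)
    also have "f N \<le> (\<Sum>N\<in>T. f N)"
      using fin N(1) slack_sign_matrix(2)[OF TS f] by (intro member_le_sum) auto
    finally have "real (Suc n) * 1 \<le> real (Suc n) * (\<Sum>N\<in>T. f N)" by (intro mult_left_mono) auto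
    moreover have "f M \<le> real (Suc n) * 1" using slack_sign_matrix(3)[OF M f] by simp
    ultimately show ?thesis by (rule order_trans[rotated])
  qed
  have Y_lin: "f Y = real (Suc n) * (\<Sum>N\<in>T. f N) - f M" if "linear f" for f :: "matrix \<Rightarrow> real"
    using that by (simp add: Y_def linear_diff linear_scale linear_sum)
  have entry_Y: "Poly_Mapping.lookup Y k =
      real (Suc n) * (\<Sum>N\<in>T. Poly_Mapping.lookup N k) - Poly_Mapping.lookup M k" for k
    by (simp add: Y_def lookup_minus lookup_sum)
  have int: "entry N i j \<in> \<int>" if "N \<in> sign_matrices m n" for N i j
    using sign_matrix_entry[OF that, of i j] by auto
  obtain Z where Z: "\<And>t. t < D \<Longrightarrow> Z t \<in> sign_matrices m n" and YZ: "Y = (\<Sum>t<D. Z t)"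
  proof (rule sum_of_sign_matrices[OF D, of Y m n])
    show "Poly_Mapping.keys Y \<subseteq> {1..m} \<times> {1..n}"
    proof
      fix k assume k: "k \<in> Poly_Mapping.keys Y"
      show "k \<in> {1..m} \<times> {1..n}"
      proof (rule ccontr)
        assume "k \<notin> {1..m} \<times> {1..n}"
        then have "Poly_Mapping.lookup N k = 0" if "N \<in> insert M T" for N
          using that TS M sign_matrix_outside by blast
        then have "Poly_Mapping.lookup Y k = 0" by (simp add: entry_Y)
        with k show False by (simp add: in_keys_iff)
      qed
    qed
    show "entry Y i j \<in> \<int>" for i j
      unfolding entry_Y using int TS M by (intro Ints_diff Ints_mult Ints_sum) auto
    fix i j assume ij: "i \<in> {1..m}" "j \<in> {1..n}"
    note f = slacksI[OF this]
    have "real K = real (Suc n) * real (card T)" by (simp only: K_def of_nat_mult)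
    then have "real D = real (Suc n) * real (card T) - 1" using KD by simp
    \<comment> \<open>The upper bound is \<open>slack_sum\<close> for \<open>1 - col_psum\<close>:
      the constants contribute \<open>Suc n * card T\<close> on one side and 1 on the other, leaving
      \<open>D\<close>.\<close>
    then show "0 \<le> col_psum Y i j \<and> col_psum Y i j \<le> D"
      using slack_sum[OF f(1)] slack_sum[OF f(2)]
      by (simp add: Y_lin[OF linear_col_psum] sum_subtractf algebra_simps)
    show "0 \<le> row_psum Y i j"
      using slack_sum[OF f(3)] by (simp add: Y_lin[OF linear_row_psum])
  qed blast
  \<comment> \<open>The \<open>D\<close> summands of \<open>Y\<close>, followed by \<open>M\<close>
    at index \<open>D\<close>. Their mean is the barycentre of \<open>T\<close>, a point of
    \<open>F\<close>, in which \<open>M\<close> has weight \<open>1 / K\<close>.\<close>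
  define x where "x t = (if t < D then Z t else M)" for t
  have x: "x t \<in> sign_polytope m n" for t
    using Z M by (simp add: x_def sign_polytope_def hull_inc)
  have "(\<Sum>t<K. x t) = Y + M"
    by (simp add: KD x_def YZ)
  also have "\<dots> = real (Suc n) *\<^sub>R (\<Sum>N\<in>T. N)" by (simp add: Y_def)
  finally have "(\<Sum>t<K. (1 / real K) *\<^sub>R x t) = (real (Suc n) / real K) *\<^sub>R (\<Sum>N\<in>T. N)"
    by (simp flip: scaleR_sum_right)
  also have "real (Suc n) / real K = 1 / card T"
    unfolding K_def of_nat_mult by simp
  also have "(1 / card T) *\<^sub>R (\<Sum>N\<in>T. N) = (\<Sum>N\<in>T. (1 / card T) *\<^sub>R N)"
    by (rule scaleR_sum_right)
  also have "\<dots> \<in> F"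
    using fin card face_of_imp_convex[OF F] by (intro convex_sum) (auto simp: T_def)
  finally have "x D \<in> F"
    using F x KD by (intro face_of_mem_weighted_sum[of F _ "{..<K}" "\<lambda>t. 1 / K" x D])
      (auto simp: sign_polytope_def)
  then show ?thesis by (simp add: x_def)
qed

section \<open>Labelings\<close>

lemma ball_slacks:
  "(\<forall>f\<in>slacks m n. Q f) \<longleftrightarrow> (\<forall>i\<in>{1..m}. \<forall>j\<in>{1..n}.
     Q (\<lambda>M. col_psum M i j) \<and> Q (\<lambda>M. 1 - col_psum M i j) \<and> Q (\<lambda>M. row_psum M i j))"
  by (simp add: slacks_def ball_UN)

text \<open>A vertical label is the set of values of a column partial sum, and a horizontal label on
  a nonempty set tells whether a row partial sum vanishes throughout. Equal labels thus mean the
  same tight inequalities.\<close>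

lemma labeling_Union_zero_dim_eq_iff:
  assumes mn: "m > 0" "n > 0" and S: "S \<subseteq> sign_matrices m n" and T: "T \<subseteq> sign_matrices m n"
  shows "labeling_Union (zero_dim_component m n ` S) = labeling_Union (zero_dim_component m n ` T) \<longleftrightarrow>
    (\<forall>f\<in>slacks m n. (\<forall>M\<in>S. f M = 0) \<longleftrightarrow> (\<forall>M\<in>T. f M = 0))" (is "?L S = ?L T \<longleftrightarrow> _")
proof -
  have v: "vlabel (?L S) ((i, j), (i + 1, j)) = (\<lambda>M. col_psum M i j) ` S"
    if "i \<in> {1..m}" "j \<in> {1..n}" for i j S
    using that by (auto simp: labeling_Union_def zero_dim_component_def vertical_edges_def)
  have v': "vlabel (?L S) e = {}" if "e \<notin> vertical_edges m n" for e S
    using that by (auto simp: labeling_Union_def zero_dim_component_def split: prod.splits)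
  have h: "hlabel (?L S) ((i, j), (i, j + 1)) =
      (if S = {} then None else if \<forall>M\<in>S. row_psum M i j = 0 then Some Zero else Some Star)"
    if "i \<in> {1..m}" "j \<in> {1..n}" for i j S
    using that by (auto simp: labeling_Union_def zero_dim_component_def horizontal_edges_def)
  have h': "hlabel (?L S) e = None" if "e \<notin> horizontal_edges m n" for e S
    using that by (simp add: labeling_Union_def zero_dim_component_def split_beta)
  have c: "col_psum M i j \<in> {0, 1}" if "i \<in> {1..m}" "j \<in> {1..n}" "M \<in> S \<union> T" for i j M
  proof -
    have "M \<in> sign_matrices m n" using that(3) S T by blast
    then show ?thesis using that(1,2) by (simp add: sign_matrices_def)
  qed
  have image_eq: "(\<lambda>M. col_psum M i j) ` S = (\<lambda>M. col_psum M i j) ` T \<longleftrightarrow>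
      ((\<forall>M\<in>S. col_psum M i j = 0) \<longleftrightarrow> (\<forall>M\<in>T. col_psum M i j = 0)) \<and>
      ((\<forall>M\<in>S. 1 - col_psum M i j = 0) \<longleftrightarrow> (\<forall>M\<in>T. 1 - col_psum M i j = 0))"
    if ij: "i \<in> {1..m}" "j \<in> {1..n}" for i j
  proof -
    \<comment> \<open>The four subsets of \<open>{0, 1}\<close> are told apart by these two tests;
      only the empty set passes both.\<close>
    have two: "A = B \<longleftrightarrow> ((\<forall>a\<in>A. a = 0) \<longleftrightarrow> (\<forall>a\<in>B. a = 0)) \<and> ((\<forall>a\<in>A. a = 1) \<longleftrightarrow> (\<forall>a\<in>B. a = 1))"
      if "A \<subseteq> {0, 1}" "B \<subseteq> {0, 1}" for A B :: "real set"
    proof -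
      have "A \<in> Pow {0, 1}" "B \<in> Pow {0, 1}" using that by auto
      then show ?thesis by (auto simp: Pow_insert)
    qed
    show ?thesis
      using two[of "(\<lambda>M. col_psum M i j) ` S" "(\<lambda>M. col_psum M i j) ` T"] c[OF ij] by auto
  qed
  have "?L S = ?L T \<longleftrightarrow> vlabel (?L S) = vlabel (?L T) \<and> hlabel (?L S) = hlabel (?L T)"
    by auto
  also have "vlabel (?L S) = vlabel (?L T) \<longleftrightarrow> (\<forall>i\<in>{1..m}. \<forall>j\<in>{1..n}.
      vlabel (?L S) ((i, j), (i + 1, j)) = vlabel (?L T) ((i, j), (i + 1, j)))" (is "_ \<longleftrightarrow> ?V")
  proof
    assume ?V
    then have "vlabel (?L S) e = vlabel (?L T) e" if "e \<in> vertical_edges m n" for e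
      using that by (auto simp: vertical_edges_def)
    then show "vlabel (?L S) = vlabel (?L T)" using v' by (metis ext)
  qed simp
  also have "hlabel (?L S) = hlabel (?L T) \<longleftrightarrow> (\<forall>i\<in>{1..m}. \<forall>j\<in>{1..n}.
      hlabel (?L S) ((i, j), (i, j + 1)) = hlabel (?L T) ((i, j), (i, j + 1)))" (is "_ \<longleftrightarrow> ?H")
  proof
    assume ?H
    then have "hlabel (?L S) e = hlabel (?L T) e" if "e \<in> horizontal_edges m n" for e
      using that by (auto simp: horizontal_edges_def)
    then show "hlabel (?L S) = hlabel (?L T)" using h' by (metis ext)
  qed simp
  finally have *: "?L S = ?L T \<longleftrightarrow> (\<forall>i\<in>{1..m}. \<forall>j\<in>{1..n}.
      ((\<forall>M\<in>S. col_psum M i j = 0) \<longleftrightarrow> (\<forall>M\<in>T. col_psum M i j = 0)) \<and>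
      ((\<forall>M\<in>S. 1 - col_psum M i j = 0) \<longleftrightarrow> (\<forall>M\<in>T. 1 - col_psum M i j = 0))) \<and>
      (\<forall>i\<in>{1..m}. \<forall>j\<in>{1..n}. hlabel (?L S) ((i, j), (i, j + 1)) = hlabel (?L T) ((i, j), (i, j + 1)))"
    by (simp only: v image_eq cong: ball_cong)
  \<comment> \<open>The vertical edge below vertex (1, 1), which exists as \<open>m\<close> and
    \<open>n\<close> are positive, has an empty label exactly for the empty set.\<close>
  have empty: "S = {} \<longleftrightarrow> T = {}"
    if "\<forall>i\<in>{1..m}. \<forall>j\<in>{1..n}.
      ((\<forall>M\<in>S. col_psum M i j = 0) \<longleftrightarrow> (\<forall>M\<in>T. col_psum M i j = 0)) \<and>
      ((\<forall>M\<in>S. 1 - col_psum M i j = 0) \<longleftrightarrow> (\<forall>M\<in>T. 1 - col_psum M i j = 0))"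
  proof -
    have "1 \<in> {1..m}" "1 \<in> {1..n}" using mn by auto
    then have "(\<lambda>M. col_psum M 1 1) ` S = (\<lambda>M. col_psum M 1 1) ` T"
      using image_eq[of 1 1] that by blast
    then show ?thesis by (metis image_is_empty)
  qed
  have slack_iff: "(\<forall>f\<in>slacks m n. (\<forall>M\<in>S. f M = 0) \<longleftrightarrow> (\<forall>M\<in>T. f M = 0)) \<longleftrightarrow>
    (\<forall>i\<in>{1..m}. \<forall>j\<in>{1..n}.
      ((\<forall>M\<in>S. col_psum M i j = 0) \<longleftrightarrow> (\<forall>M\<in>T. col_psum M i j = 0)) \<and>
      ((\<forall>M\<in>S. 1 - col_psum M i j = 0) \<longleftrightarrow> (\<forall>M\<in>T. 1 - col_psum M i j = 0))) \<and>
    (\<forall>i\<in>{1..m}. \<forall>j\<in>{1..n}. (\<forall>M\<in>S. row_psum M i j = 0) \<longleftrightarrow> (\<forall>M\<in>T. row_psum M i j = 0))"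
    unfolding ball_slacks by blast
  \<comment> \<open>\<open>conj_cong\<close> makes the vertical conditions available for the
    horizontal ones. They show that \<open>S\<close> and \<open>T\<close> are empty together, so
    that \<open>None\<close> never meets a proper label.\<close>
  show ?thesis
    unfolding * slack_iff
  proof (intro conj_cong refl, drule empty, intro ball_cong refl)
    fix i j assume e: "S = {} \<longleftrightarrow> T = {}" and ij: "i \<in> {1..m}" "j \<in> {1..n}"
    have "(if P then Some Zero else Some Star) = (if Q then Some Zero else Some Star) \<longleftrightarrow> P = Q" for P Q
      by simp
    then show "hlabel (?L S) ((i, j), (i, j + 1)) = hlabel (?L T) ((i, j), (i, j + 1)) \<longleftrightarrow>
        (\<forall>M\<in>S. row_psum M i j = 0) = (\<forall>M\<in>T. row_psum M i j = 0)"
      using e unfolding h[OF ij] by (cases "S = {}") (simp_all only: if_True if_False simp_thms ball_empty)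
  qed
qed

section \<open>Bijectivity of \<open>psi\<close>\<close>

theorem theorem7p15:
  fixes m n :: nat
  assumes "m > 0" and "n > 0"
  shows "bij_betw (psi m n) (polytope_faces m n) (grid_components m n)"
proof -
  let ?L = "\<lambda>S. labeling_Union (zero_dim_component m n ` S)" and ?S = "sign_matrices m n"
  have psi: "psi m n F = ?L (?S \<inter> F)" if "F face_of sign_polytope m n" for F
    using that by (simp add: psi_def face_sign_matrices_eq)
  have comps: "grid_components m n = ?L ` Pow ?S"
  proof -
    \<comment> \<open>The empty component is the union over no matrices, so the components are the
      image of the full power set.\<close>
    have "empty_labeling = ?L {}" by (simp add: labeling_Union_empty)
    then have "grid_components m n = insert (?L {}) {?L S | S. S \<subseteq> ?S \<and> S \<noteq> {}}"
      by (simp only: grid_components_def)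
    also have "\<dots> = ?L ` Pow ?S" by (auto simp only: image_iff Pow_iff)
    finally show ?thesis .
  qed
  note L_eq = labeling_Union_zero_dim_eq_iff[OF assms]
  \<comment> \<open>Equal labelings make every inequality tight on \<open>F'\<close> tight at each
    sign matrix of \<open>F\<close>.\<close>
  have sub: "?S \<inter> F \<subseteq> F'"
    if F: "F face_of sign_polytope m n" and F': "F' face_of sign_polytope m n"
      and eq: "?L (?S \<inter> F) = ?L (?S \<inter> F')" for F F'
  proof
    fix M assume M: "M \<in> ?S \<inter> F"
    have tight: "f M = 0" if "f \<in> slacks m n" "\<forall>N\<in>?S \<inter> F'. f N = 0" for f
      using eq that M by (auto simp: L_eq)
    have "(\<lambda>M. col_psum M 1 1) \<in> slacks m n" "(\<lambda>M. 1 - col_psum M 1 1) \<in> slacks m n"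
      using slacksI[of 1 m 1 n] assms by auto
    \<comment> \<open>Otherwise both column slacks at (1, 1) would vanish vacuously on
      \<open>F'\<close>, hence at \<open>M\<close>, although they add up to 1.\<close>
    then have "?S \<inter> F' \<noteq> {}"
      using tight[of "\<lambda>M. col_psum M 1 1"] tight[of "\<lambda>M. 1 - col_psum M 1 1"] by force
    then show "M \<in> F'"
      using M tight by (intro sign_matrix_in_face[OF F' _ assms(2)]) auto
  qed
  have "inj_on (psi m n) (polytope_faces m n)"
  proof (rule inj_onI)
    fix F F' assume "F \<in> polytope_faces m n" "F' \<in> polytope_faces m n" and eq: "psi m n F = psi m n F'"
    then have F: "F face_of sign_polytope m n" "F' face_of sign_polytope m n"
      by (simp_all add: polytope_faces_def)
    then have "?S \<inter> F = ?S \<inter> F'"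
      using sub[of F F'] sub[of F' F] eq by (auto simp: psi)
    then show "F = F'"
      using F face_of_convex_hull_eq unfolding sign_polytope_def by metis
  qed
  moreover have "psi m n ` polytope_faces m n \<subseteq> grid_components m n"
    by (auto simp: polytope_faces_def psi comps)
  moreover have "?L S \<in> psi m n ` polytope_faces m n" if S: "S \<subseteq> ?S" for S
  proof -
    \<comment> \<open>The face cut out by these inequalities may contain more sign matrices than
      \<open>S\<close>, but the same inequalities are tight on them, so the label is
      unchanged.\<close>
    let ?tight = "{f \<in> slacks m n. \<forall>M\<in>S. f M = 0}"
    define F where "F = {X \<in> sign_polytope m n. \<forall>f\<in>?tight. f X = 0}"
    have F: "F face_of sign_polytope m n"
      unfolding F_def using affine_fun_slack slack_nonneg
      by (intro face_of_affine_fun_zeros) (auto simp: sign_polytope_def)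
    have "S \<subseteq> ?S \<inter> F"
      using S by (auto simp: F_def sign_polytope_def hull_inc)
    then have "?L (?S \<inter> F) = ?L S"
      using S by (subst L_eq) (auto simp: F_def)
    then show ?thesis
      using F by (force simp: polytope_faces_def psi)
  qed
  ultimately show ?thesis
    unfolding bij_betw_def comps by blast
qed

end
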